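(* Let $A$ be a Banach algebra with a right identity $u$, let $B$ be a Banach algebra, and let $\theta,\phi,\gamma$ be nonzero multiplicative linear functionals on $B$. Let $d: A\times B\to A\times B$ be a mapping. Then $d\in\mathrm{Der}_J(A\times_\theta^{\phi,\gamma}B)$ if and only if the following statements hold. (i) There exist unique Jordan derivations $d_A\in\mathrm{Der}_J(A)$ and $d_B\in\mathrm{Der}_J(B)$ such that $$d(a,b)=\Big(d_A(a)+(2\theta-\phi-\gamma)(b)\,d_A(u)-\tfrac12(\phi+\gamma)(d_B(b))\,u,\ d_B(b)\Big)$$ for all $a\in A$ and $b\in B$. (ii) For these $d_A,d_B$: $(2\theta-\phi-\gamma)(b)\,\big(d_A(a)-d_A(u)a\big)=\tfrac12(\phi+\gamma)(d_B(b))\,(a-ua)$ for all $a\in A$ and $b\in B$. (iii) For these $d_A,d_B$: $(\theta-\phi)(b)\,(\theta-\gamma)(b)\,d_A(u)=0$ and $(\gamma-\phi)(b)\,(\gamma-\phi)(d_B(b))\,u=0$ for all $a\in A$ and $b\in B$.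
   Context: Banach algebras are over $\mathbb{C}$. A right identity of $A$ is an element $u\in A$ with $au=a$ for all $a\in A$. A Jordan derivation on an algebra $C$ is a linear map $D:C\to C$ (no continuity assumed) with $D(c^2)=D(c)c+cD(c)$ for all $c\in C$; the set of these is denoted $\mathrm{Der}_J(C)$. For a multiplicative linear functional $\eta$ on $B$, the $\eta$-Lau product on the vector space $A\times B$ is $$(a,b)\cdot_\eta(x,y)=(ax+\eta(y)a+\eta(b)x,\ by).$$ For nonzero multiplicative linear functionals $\theta,\phi,\gamma$ on $B$, $\mathrm{Der}_J(A\times_\theta^{\phi,\gamma}B)$ denotes the set of all linear maps $d:A\times B\to A\times B$ satisfying $$d((a,b)\cdot_\theta(a,b))=d(a,b)\cdot_\phi(a,b)+(a,b)\cdot_\gamma d(a,b)\qquad(a\in A,\ b\in B).$$ Linear combinations of functionals are evaluated pointwise, e.g. $(2\theta-\phi-\gamma)(b)=2\theta(b)-\phi(b)-\gamma(b)$. *)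

theory Defs
  imports "HOL-Analysis.Analysis"
begin

text \<open>
  The library's vector space classes are over the reals; the following classes are their
  complex analogues. The class \<^class>\<open>real_normed_algebra\<close> assumes submultiplicativity of the
  norm but no unit, so algebras here need not be unital.
\<close>

class scaleC = scaleR +
  fixes scaleC :: "complex \<Rightarrow> 'a \<Rightarrow> 'a" (infixr "*\<^sub>C" 75)

class complex_vector = real_vector + scaleC +
  assumes scaleR_scaleC: "r *\<^sub>R x = complex_of_real r *\<^sub>C x"
    and scaleC_add_right: "c *\<^sub>C (x + y) = c *\<^sub>C x + c *\<^sub>C y"
    and scaleC_add_left: "(c + c') *\<^sub>C x = c *\<^sub>C x + c' *\<^sub>C x"
    and scaleC_scaleC: "c *\<^sub>C c' *\<^sub>C x = (c * c') *\<^sub>C x"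
    and scaleC_one: "1 *\<^sub>C x = x"

class complex_algebra = complex_vector + real_algebra +
  assumes mult_scaleC_left: "(c *\<^sub>C x) * y = c *\<^sub>C (x * y)"
    and mult_scaleC_right: "x * (c *\<^sub>C y) = c *\<^sub>C (x * y)"

class complex_banach_algebra = complex_algebra + real_normed_algebra + banach +
  assumes norm_scaleC: "norm (c *\<^sub>C x) = cmod c * norm x"

lemma vector_space_scaleC:
  "vector_space (scaleC :: complex \<Rightarrow> 'a::complex_vector \<Rightarrow> 'a)"
  by unfold_locales (simp_all add: scaleC_add_right scaleC_add_left scaleC_scaleC scaleC_one)

instantiation complex :: complex_banach_algebra
begin
definition scaleC_complex_def: "c *\<^sub>C (x::complex) = c * x"
instance
  by standard (simp_all add: scaleC_complex_def scaleR_conv_of_real algebra_simps norm_mult)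
end

instantiation prod :: (complex_vector, complex_vector) complex_vector
begin
definition scaleC_prod_def: "c *\<^sub>C p = (c *\<^sub>C fst p, c *\<^sub>C snd p)"
instance
  by standard
    (simp_all add: scaleC_prod_def prod_eq_iff scaleR_scaleC scaleC_add_right scaleC_add_left
      scaleC_scaleC scaleC_one)
end

abbreviation clinear :: "('a::complex_vector \<Rightarrow> 'b::complex_vector) \<Rightarrow> bool"
  where "clinear \<equiv> Vector_Spaces.linear scaleC scaleC"

definition right_identity :: "'a::complex_algebra \<Rightarrow> bool"
  where "right_identity u \<longleftrightarrow> (\<forall>a. a * u = a)"

definition multiplicative_functional :: "('b::complex_algebra \<Rightarrow> complex) \<Rightarrow> bool"
  where "multiplicative_functional \<eta> \<longleftrightarrow> clinear \<eta> \<and> (\<forall>x y. \<eta> (x * y) = \<eta> x * \<eta> y)"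

definition Der_J :: "('c::complex_algebra \<Rightarrow> 'c) set"
  where "Der_J = {D. clinear D \<and> (\<forall>c. D (c * c) = D c * c + c * D c)}"

definition lau_mult ::
  "('b::complex_algebra \<Rightarrow> complex) \<Rightarrow> 'a::complex_algebra \<times> 'b \<Rightarrow> 'a \<times> 'b \<Rightarrow> 'a \<times> 'b"
  where "lau_mult \<eta> = (\<lambda>(a, b) (x, y). (a * x + \<eta> y *\<^sub>C a + \<eta> b *\<^sub>C x, b * y))"

definition Der_J_lau ::
  "('b::complex_algebra \<Rightarrow> complex) \<Rightarrow> ('b \<Rightarrow> complex) \<Rightarrow> ('b \<Rightarrow> complex) \<Rightarrow>
    ('a::complex_algebra \<times> 'b \<Rightarrow> 'a \<times> 'b) set"
  where "Der_J_lau \<theta> \<phi> \<gamma> = {d. clinear d \<and>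
    (\<forall>a b. d (lau_mult \<theta> (a, b) (a, b)) =
      lau_mult \<phi> (d (a, b)) (a, b) + lau_mult \<gamma> (a, b) (d (a, b)))}"

end

theory Submission
  imports Defs
begin

text \<open>
  Split a linear map \<open>d\<close> into components, \<open>d (a, b) = (f a + g b, h a + k b)\<close>. The Jordan
  identity for \<open>d\<close> then separates into its parts of bidegree \<open>(2,0)\<close>, \<open>(1,1)\<close> and \<open>(0,2)\<close> in
  \<open>(a, b)\<close>. Polarizing \<open>h (a * a) = 0\<close> against the right identity gives \<open>h (a + u * a) = 0\<close>, and
  replacing \<open>a\<close> by \<open>u * a\<close> forces \<open>h = 0\<close>, so that \<open>f\<close> and \<open>k\<close> are Jordan derivations. As
  \<open>f (u * u) = f u\<close> makes \<open>u * f u\<close> vanish, the mixed part at \<open>a = u\<close> determines \<open>g\<close>; condition (ii)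
  is what remains of the mixed part, and condition (iii) is the part of bidegree \<open>(0,2)\<close>, whose
  two halves separate under left multiplication by \<open>u\<close>.
\<close>

interpretation cvec: vector_space "scaleC :: complex \<Rightarrow> 'a::complex_vector \<Rightarrow> 'a"
  by (rule vector_space_scaleC)

lemma clinear_iff:
  "clinear f \<longleftrightarrow> (\<forall>x y. f (x + y) = f x + f y) \<and> (\<forall>c x. f (c *\<^sub>C x) = c *\<^sub>C f x)"
  by (auto simp: Vector_Spaces.linear_iff vector_space_scaleC)

lemma clinear_0: "clinear f \<Longrightarrow> f 0 = 0"
  unfolding clinear_iff by (metis cvec.scale_zero_left)

text \<open>The element \<open>u\<close> is idempotent, so the Jordan identity at \<open>u\<close>
  reads \<open>f u = f u + u * f u\<close>. Writing \<open>a\<close> as \<open>a * u\<close> carries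
  the vanishing of \<open>u * f u\<close> over to every \<open>a\<close>.\<close>

lemma mult_right_identity_derivation:
  fixes u :: "'a::complex_algebra"
  assumes u: "right_identity u" and f: "f \<in> Der_J"
  shows "a * f u = 0"
proof -
  have ru: "\<And>x. x * u = x"
    using u by (simp add: right_identity_def)
  have "f (u * u) = f u * u + u * f u"
    using f by (simp add: Der_J_def)
  then have "u * f u = 0"
    by (simp add: ru)
  then show ?thesis
    by (metis mult.assoc mult_zero_right ru)
qed

lemma square_annihilating_eq_0:
  fixes u :: "'a::complex_algebra" and h :: "'a \<Rightarrow> 'b::complex_vector"
  assumes u: "right_identity u" and h: "clinear h" and sq: "\<And>a. h (a * a) = 0"
  shows "h a = 0"
proof -
  have ru: "\<And>x. x * u = x"
    using u by (simp add: right_identity_def)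
  have add: "\<And>x y. h (x + y) = h x + h y"
    using h by (simp add: clinear_iff)
  have pol: "h x + h (u * x) = 0" for x
    using sq[of "x + u"] sq[of x] sq[of u] by (simp add: ring_distribs add ru add.commute)
  \<comment> \<open>Since \<open>u * (u * a) = u * a\<close>, both summands of \<open>pol\<close>
    coincide at \<open>u * a\<close>.\<close>
  have "h (u * a) + h (u * a) = 0"
    using pol[of "u * a"] by (simp add: mult.assoc[symmetric] ru)
  then have "2 *\<^sub>R h (u * a) = 0"
    by (simp add: scaleR_2)
  then show ?thesis
    using pol[of a] by simp
qed

text \<open>The first three clauses come from the \<open>A\<close>-component and the last three from
  the \<open>B\<close>-component, each time in the bidegrees (2,0), (0,2), (1,1).\<close>

lemma Der_J_lau_components:
  fixes f :: "'a::complex_algebra \<Rightarrow> 'a" and g :: "'b::complex_algebra \<Rightarrow> 'a"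
    and h :: "'a \<Rightarrow> 'b" and k :: "'b \<Rightarrow> 'b"
  assumes lin: "clinear f" "clinear g" "clinear h" "clinear k" "clinear \<theta>" "clinear \<phi>" "clinear \<gamma>"
    and d: "\<And>a b. d (a, b) = (f a + g b, h a + k b)"
  shows "d \<in> Der_J_lau \<theta> \<phi> \<gamma> \<longleftrightarrow>
    (\<forall>a. f (a * a) = f a * a + a * f a + (\<phi> (h a) + \<gamma> (h a)) *\<^sub>C a) \<and>
    (\<forall>b. g (b * b) = (\<phi> b + \<gamma> b) *\<^sub>C g b) \<and>
    (\<forall>a b. (2 * \<theta> b) *\<^sub>C f a =
      g b * a + a * g b + (\<phi> b + \<gamma> b) *\<^sub>C f a + (\<phi> (k b) + \<gamma> (k b)) *\<^sub>C a) \<and>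
    (\<forall>a. h (a * a) = 0) \<and>
    (\<forall>b. k (b * b) = k b * b + b * k b) \<and>
    (\<forall>a b. (2 * \<theta> b) *\<^sub>C h a = h a * b + b * h a)"
    (is "_ \<longleftrightarrow> ?R")
proof -
  note add = lin[unfolded clinear_iff, THEN conjunct1, rule_format]
  note scale = lin[unfolded clinear_iff, THEN conjunct2, rule_format]
  note zero = lin[THEN clinear_0]
  have "clinear d"
    unfolding clinear_iff split_paired_All
    by (simp add: d scaleC_prod_def add(1-4) scale(1-4) scaleC_add_right add_ac)
  have two: "(2 * c) *\<^sub>C x = c *\<^sub>C x + c *\<^sub>C x" for c and x :: "'c::complex_vector"
    by (simp only: mult_2 scaleC_add_left)
  have eq: "d (lau_mult \<theta> (a, b) (a, b)) =
      lau_mult \<phi> (d (a, b)) (a, b) + lau_mult \<gamma> (a, b) (d (a, b)) \<longleftrightarrow>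
    f (a * a) + (2 * \<theta> b) *\<^sub>C f a + g (b * b) =
      (f a * a + a * f a + (\<phi> (h a) + \<gamma> (h a)) *\<^sub>C a) +
      (g b * a + a * g b + (\<phi> b + \<gamma> b) *\<^sub>C f a + (\<phi> (k b) + \<gamma> (k b)) *\<^sub>C a) +
      (\<phi> b + \<gamma> b) *\<^sub>C g b \<and>
    h (a * a) + (2 * \<theta> b) *\<^sub>C h a + k (b * b) = (h a * b + b * h a) + (k b * b + b * k b)" for a b
    by (simp add: lau_mult_def d add scale two scaleC_add_right scaleC_add_left distrib_left
        distrib_right add_ac)
  have "(\<forall>a b. d (lau_mult \<theta> (a, b) (a, b)) =
      lau_mult \<phi> (d (a, b)) (a, b) + lau_mult \<gamma> (a, b) (d (a, b))) \<longleftrightarrow> ?R"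
    (is "?L \<longleftrightarrow> _")
  proof
    assume "?L"
    note L = this[unfolded eq, rule_format]
    \<comment> \<open>Setting one variable to zero isolates the two pure parts; once they are
      cancelled from the full identity, the mixed part remains in \<open>ab\<close>.\<close>
    have a: "f (a * a) = f a * a + a * f a + (\<phi> (h a) + \<gamma> (h a)) *\<^sub>C a" "h (a * a) = 0" for a
      using L[of a 0] by (simp_all add: zero)
    have b: "g (b * b) = (\<phi> b + \<gamma> b) *\<^sub>C g b" "k (b * b) = k b * b + b * k b" for b
      using L[of 0 b] by (simp_all add: zero)
    have ab: "(2 * \<theta> b) *\<^sub>C f a =
        g b * a + a * g b + (\<phi> b + \<gamma> b) *\<^sub>C f a + (\<phi> (k b) + \<gamma> (k b)) *\<^sub>C a"
      "(2 * \<theta> b) *\<^sub>C h a = h a * b + b * h a" for a b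
      using L[of a b] unfolding a b by simp_all
    show ?R
      using a b ab by blast
  next
    assume ?R
    then show ?L
      unfolding eq by simp
  qed
  with \<open>clinear d\<close> show ?thesis
    by (simp add: Der_J_lau_def)
qed

text \<open>The summands of the asserted formula beyond \<open>f a\<close> are the entry
  \<open>g\<close> of \<open>d\<close>, which has to be computed from \<open>f u\<close> and
  \<open>k\<close>.\<close>

lemma Der_J_lau_components_exist:
  fixes u :: "'a::complex_algebra"
    and \<theta> \<phi> \<gamma> :: "'b::complex_algebra \<Rightarrow> complex"
  assumes u: "right_identity u"
    and lin: "clinear \<theta>" "clinear \<phi>" "clinear \<gamma>"
    and d: "d \<in> Der_J_lau \<theta> \<phi> \<gamma>"
  shows "\<exists>f k. f \<in> Der_J \<and> k \<in> Der_J \<and> (\<forall>a b. d (a, b) =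
      (f a + (2 * \<theta> b - \<phi> b - \<gamma> b) *\<^sub>C f u - ((1/2) * (\<phi> (k b) + \<gamma> (k b))) *\<^sub>C u, k b))"
proof -
  have ru: "\<And>x. x * u = x"
    using u by (simp add: right_identity_def)
  define f g h k where "f a = fst (d (a, 0))" and "g b = fst (d (0, b))"
    and "h a = snd (d (a, 0))" and "k b = snd (d (0, b))" for a b
  have "clinear d"
    using d by (simp add: Der_J_lau_def)
  then have add: "d (x + y) = d x + d y" and scale: "d (c *\<^sub>C x) = c *\<^sub>C d x" for x y c
    unfolding clinear_iff by blast+
  have add1: "d (x + y, 0) = d (x, 0) + d (y, 0)" and add2: "d (0, z + w) = d (0, z) + d (0, w)"
    and scale1: "d (c *\<^sub>C x, 0) = c *\<^sub>C d (x, 0)" and scale2: "d (0, c *\<^sub>C z) = c *\<^sub>C d (0, z)"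
    for x y z w c
    by (simp_all add: add[symmetric] scale[symmetric]) (simp_all add: scaleC_prod_def)
  have clin: "clinear f" "clinear g" "clinear h" "clinear k"
    by (simp_all add: clinear_iff f_def g_def h_def k_def add1 add2 scale1 scale2)
      (simp_all add: scaleC_prod_def)
  have dec: "d (a, b) = (f a + g b, h a + k b)" for a b
    using add[of "(a, 0)" "(0, b)"] by (simp add: f_def g_def h_def k_def prod_eq_iff)
  note comps = d[unfolded Der_J_lau_components[OF clin lin dec]]
  have h0: "h a = 0" for a
    using square_annihilating_eq_0[OF u clin(3)] comps by blast
  have f: "f \<in> Der_J" and k: "k \<in> Der_J"
    using comps clin by (simp_all add: Der_J_def h0 lin[THEN clinear_0])
  have uf: "u * f u = 0"
    by (rule mult_right_identity_derivation[OF u f])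
  have g: "g b = (2 * \<theta> b - \<phi> b - \<gamma> b) *\<^sub>C f u - ((1/2) * (\<phi> (k b) + \<gamma> (k b))) *\<^sub>C u" for b
  proof -
    let ?\<tau> = "2 * \<theta> b - \<phi> b - \<gamma> b" and ?\<kappa> = "\<phi> (k b) + \<gamma> (k b)"
    have "(2 * \<theta> b) *\<^sub>C f u = g b + u * g b + (\<phi> b + \<gamma> b) *\<^sub>C f u + ?\<kappa> *\<^sub>C u"
      using comps by (metis ru)
    then have mixed: "?\<tau> *\<^sub>C f u = g b + u * g b + ?\<kappa> *\<^sub>C u"
      by (simp add: algebra_simps)
    \<comment> \<open>\<open>mixed\<close> contains both \<open>g b\<close> and
      \<open>u * g b\<close>. Multiplying it by \<open>u\<close> on the left removes
      \<open>f u\<close> and leaves an equation for \<open>u * g b\<close> alone.\<close>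
    have "0 = u * (?\<tau> *\<^sub>C f u)"
      by (simp add: mult_scaleC_right uf)
    also have "\<dots> = u * g b + u * g b + ?\<kappa> *\<^sub>C u"
      unfolding mixed by (simp add: ring_distribs mult.assoc[symmetric] ru mult_scaleC_right)
    finally have "2 *\<^sub>C (u * g b) = - (?\<kappa> *\<^sub>C u)"
      using scaleC_add_left[of 1 1 "u * g b"] by (simp add: eq_neg_iff_add_eq_0)
    then have "(1/2) *\<^sub>C 2 *\<^sub>C (u * g b) = - ((1/2) *\<^sub>C ?\<kappa> *\<^sub>C u)"
      by simp
    then have ug: "u * g b = - ((1/2) *\<^sub>C ?\<kappa> *\<^sub>C u)"
      by (simp add: scaleC_scaleC)
    \<comment> \<open>One half cancels against \<open>u * g b\<close> in \<open>mixed\<close>; the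
      other is the coefficient 1/2 in the formula for \<open>g b\<close>.\<close>
    have half: "?\<kappa> *\<^sub>C u = (1/2) *\<^sub>C ?\<kappa> *\<^sub>C u + (1/2) *\<^sub>C ?\<kappa> *\<^sub>C u"
      by (simp flip: scaleC_add_left)
    show ?thesis
      using mixed unfolding ug by (subst (asm) half) (simp add: scaleC_scaleC)
  qed
  have "\<forall>a b. d (a, b) =
      (f a + (2 * \<theta> b - \<phi> b - \<gamma> b) *\<^sub>C f u - ((1/2) * (\<phi> (k b) + \<gamma> (k b))) *\<^sub>C u, k b)"
    by (simp add: dec h0 g add_diff_eq)
  with f k show ?thesis
    by (intro exI conjI)
qed

text \<open>For a map already in the represented form, \<open>h = 0\<close> and the Jordan property
  of \<open>f\<close> and \<open>k\<close> settle four of the six component clauses. The other two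
  are equivalent to (ii) and (iii), which gives both directions at once.\<close>

lemma Der_J_lau_iff:
  fixes u :: "'a::complex_algebra"
    and \<theta> \<phi> \<gamma> :: "'b::complex_algebra \<Rightarrow> complex"
  assumes u: "right_identity u"
    and mf: "multiplicative_functional \<theta>" "multiplicative_functional \<phi>"
      "multiplicative_functional \<gamma>"
    and f: "f \<in> Der_J" and k: "k \<in> Der_J"
    and d: "\<And>a b. d (a, b) =
      (f a + (2 * \<theta> b - \<phi> b - \<gamma> b) *\<^sub>C f u - ((1/2) * (\<phi> (k b) + \<gamma> (k b))) *\<^sub>C u, k b)"
  shows "d \<in> Der_J_lau \<theta> \<phi> \<gamma> \<longleftrightarrow>
    (\<forall>a b. (2 * \<theta> b - \<phi> b - \<gamma> b) *\<^sub>C (f a - f u * a) =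
      ((1/2) * (\<phi> (k b) + \<gamma> (k b))) *\<^sub>C (a - u * a)) \<and>
    (\<forall>b. ((\<theta> b - \<phi> b) * (\<theta> b - \<gamma> b)) *\<^sub>C f u = 0 \<and>
      ((\<gamma> b - \<phi> b) * (\<gamma> (k b) - \<phi> (k b))) *\<^sub>C u = 0)"
proof -
  have ru: "\<And>x. x * u = x"
    using u by (simp add: right_identity_def)
  have lin: "clinear \<theta>" "clinear \<phi>" "clinear \<gamma>"
    and mult: "\<And>x y. \<theta> (x * y) = \<theta> x * \<theta> y" "\<And>x y. \<phi> (x * y) = \<phi> x * \<phi> y"
      "\<And>x y. \<gamma> (x * y) = \<gamma> x * \<gamma> y"
    using mf by (simp_all add: multiplicative_functional_def)
  have clin: "clinear f" "clinear k"
    and jordan: "\<And>a. f (a * a) = f a * a + a * f a" "\<And>b. k (b * b) = k b * b + b * k b"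
    using f k by (simp_all add: Der_J_def)
  note linD = clin[unfolded clinear_iff] lin[unfolded clinear_iff]
  have af: "a * f u = 0" for a
    by (rule mult_right_identity_derivation[OF u f])
  define g where
    "g b = (2 * \<theta> b - \<phi> b - \<gamma> b) *\<^sub>C f u - ((1/2) * (\<phi> (k b) + \<gamma> (k b))) *\<^sub>C u" for b
  have "clinear g"
    unfolding clinear_iff g_def
    by (simp add: linD scaleC_complex_def scaleC_scaleC algebra_simps)
  have "clinear (\<lambda>_::'a. 0::'b)"
    by (simp add: clinear_iff)
  have dec: "d (a, b) = (f a + g b, 0 + k b)" for a b
    by (simp add: d g_def)
  have mixed: "(2 * \<theta> b) *\<^sub>C f a =
      g b * a + a * g b + (\<phi> b + \<gamma> b) *\<^sub>C f a + (\<phi> (k b) + \<gamma> (k b)) *\<^sub>C a \<longleftrightarrow>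
    (2 * \<theta> b - \<phi> b - \<gamma> b) *\<^sub>C (f a - f u * a) =
      ((1/2) * (\<phi> (k b) + \<gamma> (k b))) *\<^sub>C (a - u * a)" (is "?l = ?r \<longleftrightarrow> ?l' = ?r'") for a b
  proof -
    let ?c = "(1/2) * (\<phi> (k b) + \<gamma> (k b))"
    have half: "(\<phi> (k b) + \<gamma> (k b)) *\<^sub>C a = ?c *\<^sub>C a + ?c *\<^sub>C a"
      by (simp flip: scaleC_add_left)
    \<comment> \<open>As \<open>a * f u = 0\<close>, the term \<open>a * g b\<close> is just
      \<open>a\<close> scaled by \<open>- ?c\<close>, which cancels one of the two halves.\<close>
    have "?l - ?r = ?l' - ?r'"
      unfolding half
      by (simp only: g_def ring_distribs mult_scaleC_left mult_scaleC_right af ru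
          cvec.scale_right_diff_distrib cvec.scale_left_diff_distrib scaleC_add_left) simp
    then show ?thesis
      by (metis eq_iff_diff_eq_0)
  qed
  have square: "g (b * b) = (\<phi> b + \<gamma> b) *\<^sub>C g b \<longleftrightarrow>
    ((\<theta> b - \<phi> b) * (\<theta> b - \<gamma> b)) *\<^sub>C f u = 0 \<and>
    ((\<gamma> b - \<phi> b) * (\<gamma> (k b) - \<phi> (k b))) *\<^sub>C u = 0" (is "_ \<longleftrightarrow> ?p *\<^sub>C _ = 0 \<and> ?q *\<^sub>C _ = 0") for b
  proof -
    have diff: "g (b * b) - (\<phi> b + \<gamma> b) *\<^sub>C g b = (2 * ?p) *\<^sub>C f u - ((1/2) * ?q) *\<^sub>C u"
    proof -
      \<comment> \<open>Each coefficient becomes its value at \<open>b * b\<close> minus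
        \<open>\<phi> b + \<gamma> b\<close> times its value at \<open>b\<close>, the shape that
        \<open>factor\<close> recombines. For \<open>q\<close>, a multiplicative functional turns
        the Jordan identity into \<open>\<phi> (k (b * b)) = 2 * \<phi> b * \<phi> (k b)\<close>,
        and likewise for \<open>\<gamma>\<close>.\<close>
      have p: "2 * ?p = (2 * \<theta> (b * b) - \<phi> (b * b) - \<gamma> (b * b))
          - (\<phi> b + \<gamma> b) * (2 * \<theta> b - \<phi> b - \<gamma> b)"
        by (simp add: mult algebra_simps)
      have q: "(1/2) * ?q = (1/2) * (\<phi> (k (b * b)) + \<gamma> (k (b * b)))
          - (\<phi> b + \<gamma> b) * ((1/2) * (\<phi> (k b) + \<gamma> (k b)))"
        by (simp add: mult jordan linD field_simps)
      have factor: "(x - c * y) *\<^sub>C v - (x' - c * y') *\<^sub>C w =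
          (x *\<^sub>C v - x' *\<^sub>C w) - c *\<^sub>C (y *\<^sub>C v - y' *\<^sub>C w)"
        for c x y x' y' and v w :: 'a
        by (simp add: cvec.scale_left_diff_distrib cvec.scale_right_diff_distrib scaleC_scaleC)
      show ?thesis
        unfolding p q g_def factor ..
    qed
    have "(2 * ?p) *\<^sub>C f u = 0 \<and> ((1/2) * ?q) *\<^sub>C u = 0"
      if eq: "(2 * ?p) *\<^sub>C f u - ((1/2) * ?q) *\<^sub>C u = 0"
    proof -
      \<comment> \<open>Left multiplication by \<open>u\<close> annihilates \<open>f u\<close> and
        fixes \<open>u\<close>.\<close>
      have "u * ((2 * ?p) *\<^sub>C f u - ((1/2) * ?q) *\<^sub>C u) = 0"
        unfolding eq by simp
      then have "((1/2) * ?q) *\<^sub>C u = 0"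
        by (simp only: right_diff_distrib mult_scaleC_right af ru) simp
      with eq show ?thesis
        by simp
    qed
    then have "(2 * ?p) *\<^sub>C f u - ((1/2) * ?q) *\<^sub>C u = 0 \<longleftrightarrow> ?p *\<^sub>C f u = 0 \<and> ?q *\<^sub>C u = 0"
      by auto
    then show ?thesis
      by (simp only: eq_iff_diff_eq_0[of "g (b * b)"] diff)
  qed
  have trivial: "\<forall>a. f (a * a) = f a * a + a * f a + (\<phi> 0 + \<gamma> 0) *\<^sub>C a"
    "\<forall>b. k (b * b) = k b * b + b * k b"
    "\<forall>(a::'a) b. (2 * \<theta> b) *\<^sub>C (0::'b) = 0 * b + b * 0"
    by (simp_all add: jordan lin[THEN clinear_0])
  note comps = Der_J_lau_components[where f = f and g = g and h = "\<lambda>_. 0" and k = k and d = d,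
      OF clin(1) \<open>clinear g\<close> \<open>clinear (\<lambda>_. 0)\<close> clin(2) lin dec]
  show ?thesis
    \<comment> \<open>The clause of bidegree (0,2) precedes the mixed one, so (iii) and (ii) appear
      in reverse order.\<close>
    unfolding comps mixed square
    by (simp only: trivial simp_thms) (rule conj_commute)
qed

theorem theorem2p2:
  fixes u :: "'a::complex_banach_algebra"
    and \<theta> \<phi> \<gamma> :: "'b::complex_banach_algebra \<Rightarrow> complex"
    and d :: "'a \<times> 'b \<Rightarrow> 'a \<times> 'b"
  assumes "right_identity u"
    and "multiplicative_functional \<theta>" and "\<theta> \<noteq> (\<lambda>_. 0)"
    and "multiplicative_functional \<phi>" and "\<phi> \<noteq> (\<lambda>_. 0)"
    and "multiplicative_functional \<gamma>" and "\<gamma> \<noteq> (\<lambda>_. 0)"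
  shows "d \<in> Der_J_lau \<theta> \<phi> \<gamma> \<longleftrightarrow>
    (\<exists>!(d\<^sub>A, d\<^sub>B). d\<^sub>A \<in> Der_J \<and> d\<^sub>B \<in> Der_J \<and>
      (\<forall>a b. d (a, b) =
        (d\<^sub>A a + (2 * \<theta> b - \<phi> b - \<gamma> b) *\<^sub>C d\<^sub>A u
           - ((1/2) * (\<phi> (d\<^sub>B b) + \<gamma> (d\<^sub>B b))) *\<^sub>C u, d\<^sub>B b))) \<and>
    (\<forall>d\<^sub>A d\<^sub>B. d\<^sub>A \<in> Der_J \<and> d\<^sub>B \<in> Der_J \<and>
      (\<forall>a b. d (a, b) =
        (d\<^sub>A a + (2 * \<theta> b - \<phi> b - \<gamma> b) *\<^sub>C d\<^sub>A u
           - ((1/2) * (\<phi> (d\<^sub>B b) + \<gamma> (d\<^sub>B b))) *\<^sub>C u, d\<^sub>B b)) \<longrightarrow>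
      (\<forall>a b. (2 * \<theta> b - \<phi> b - \<gamma> b) *\<^sub>C (d\<^sub>A a - d\<^sub>A u * a) =
        ((1/2) * (\<phi> (d\<^sub>B b) + \<gamma> (d\<^sub>B b))) *\<^sub>C (a - u * a)) \<and>
      (\<forall>b. ((\<theta> b - \<phi> b) * (\<theta> b - \<gamma> b)) *\<^sub>C d\<^sub>A u = 0 \<and>
        ((\<gamma> b - \<phi> b) * (\<gamma> (d\<^sub>B b) - \<phi> (d\<^sub>B b))) *\<^sub>C u = 0))"
proof -
  let ?rep = "\<lambda>d\<^sub>A d\<^sub>B. d\<^sub>A \<in> Der_J \<and> d\<^sub>B \<in> Der_J \<and>
      (\<forall>a b. d (a, b) =
        (d\<^sub>A a + (2 * \<theta> b - \<phi> b - \<gamma> b) *\<^sub>C d\<^sub>A u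
           - ((1/2) * (\<phi> (d\<^sub>B b) + \<gamma> (d\<^sub>B b))) *\<^sub>C u, d\<^sub>B b))"
  have lin: "clinear \<theta>" "clinear \<phi>" "clinear \<gamma>"
    using assms by (simp_all add: multiplicative_functional_def)
  \<comment> \<open>At \<open>(a, 0)\<close> and \<open>(0, b)\<close> the correction terms drop out
    of the relevant component, so \<open>d\<close> determines both maps.\<close>
  have unique: "f = (\<lambda>a. fst (d (a, 0))) \<and> k = (\<lambda>b. snd (d (0, b)))" if "?rep f k" for f k
  proof -
    have "k 0 = 0"
      using that by (simp add: Der_J_def clinear_0)
    with that show ?thesis
      by (simp add: lin[THEN clinear_0])
  qed
  \<comment> \<open>Uniqueness is automatic, so only existence has to be shown, and a quantifier
    over all representing pairs concerns at most one pair.\<close>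
  have ex1: "(\<exists>!(f, k). ?rep f k) \<longleftrightarrow> (\<exists>f k. ?rep f k)"
  proof
    assume "\<exists>f k. ?rep f k"
    then obtain f k where rep: "?rep f k"
      by blast
    show "\<exists>!(f, k). ?rep f k"
    proof (rule ex1I[of _ "(f, k)"])
      show "case (f, k) of (f, k) \<Rightarrow> ?rep f k"
        using rep by simp
      show "p = (f, k)" if "case p of (f, k) \<Rightarrow> ?rep f k" for p
      proof -
        have "?rep (fst p) (snd p)"
          using that unfolding case_prod_beta .
        from unique[OF this] unique[OF rep] show ?thesis
          by (simp only: prod_eq_iff fst_conv snd_conv)
      qed
    qed
  qed auto
  let ?cond = "\<lambda>d\<^sub>A d\<^sub>B.
      (\<forall>a b. (2 * \<theta> b - \<phi> b - \<gamma> b) *\<^sub>C (d\<^sub>A a - d\<^sub>A u * a) =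
        ((1/2) * (\<phi> (d\<^sub>B b) + \<gamma> (d\<^sub>B b))) *\<^sub>C (a - u * a)) \<and>
      (\<forall>b. ((\<theta> b - \<phi> b) * (\<theta> b - \<gamma> b)) *\<^sub>C d\<^sub>A u = 0 \<and>
        ((\<gamma> b - \<phi> b) * (\<gamma> (d\<^sub>B b) - \<phi> (d\<^sub>B b))) *\<^sub>C u = 0)"
  have iff: "d \<in> Der_J_lau \<theta> \<phi> \<gamma> \<longleftrightarrow> ?cond f k" if "?rep f k" for f k
    by (rule Der_J_lau_iff[where f = f and k = k and d = d, OF assms(1,2,4,6)])
      (simp_all only: that)
  have exists: "\<exists>f k. ?rep f k" if "d \<in> Der_J_lau \<theta> \<phi> \<gamma>"
    by (rule Der_J_lau_components_exist[OF assms(1) lin that])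
  show ?thesis
    unfolding ex1
  proof (rule iffI)
    assume d: "d \<in> Der_J_lau \<theta> \<phi> \<gamma>"
    have "\<forall>f k. ?rep f k \<longrightarrow> ?cond f k"
      by (rule allI, rule allI, rule impI, rule iffD1[OF iff d])
    with exists[OF d] show "(\<exists>f k. ?rep f k) \<and> (\<forall>f k. ?rep f k \<longrightarrow> ?cond f k)"
      by (rule conjI)
  next
    assume R: "(\<exists>f k. ?rep f k) \<and> (\<forall>f k. ?rep f k \<longrightarrow> ?cond f k)"
    obtain f k where r: "?rep f k"
      using R[THEN conjunct1] by blast
    have "?cond f k"
      by (rule R[THEN conjunct2, THEN spec, THEN spec, THEN mp, OF r])
    with iff[OF r] show "d \<in> Der_J_lau \<theta> \<phi> \<gamma>"
      by (rule iffD2)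
  qed
qed

end
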